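(* Let $\mathcal{A}$ be a variety of $\Omega$-groups and $\mathcal{B}\le\mathcal{A}$ a subvariety. Let $N$ be an ideal of $A\in\mathcal{A}$. Then the extension $N\to A$ is a $\mathcal{B}$-central extension in the sense of Fröhlich if and only if $[N,A]_{\mathcal{B}}=\{1\}$.
   Context: A variety of $\Omega$-groups is a variety of universal algebras which has amongst its operations and identities those of the variety of groups but has no more than one constant (the unit $1$); thus $\{1\}$ is a subalgebra of every algebra, i.e. every operation $\omega$ satisfies $\omega(1,\dots,1)=1$. Its algebras are called $\Omega$-groups. An ideal of an $\Omega$-group $A$ is a subalgebra of $A$ that is the kernel of some homomorphism $A\to B$ in $\mathcal{A}$. The inclusion $N\to A$ of an ideal $N$ is called an extension. For subalgebras $M,N$ of $A$, $M\vee N$ is the subalgebra generated by $M\cup N$ and $M\wedge N$ is the intersection. Bold letters denote finite tuples; for tuples $\mathbf{x}=(x_1,\dots,x_r)$, $\mathbf{y}=(y_1,\dots,y_r)$ write $\mathbf{x}\mathbf{y}=(x_1y_1,\dots,x_ry_r)$, and $\mathbf{m}\in M$ means that all entries of $\mathbf{m}$ lie in $M$. Let $W=W_{\mathcal{B}}=\{v(\mathbf{x}) \mid v(\mathbf{b})=1 \text{ for all } B\in\mathcal{B} \text{ and all } \mathbf{b}\in B\}$, a set of terms, i.e. of elements of the free $\Omega$-group $F_{\mathcal{A}}(\mathbb{N})$ of $\mathcal{A}$ on a countable set. For $A\in\mathcal{A}$ and ideals $M,N$ of $A$, the commutator $[M,N]_{\mathcal{B}}$ is the ideal of $M\vee N$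 generated by the set $$\{v(\mathbf{m}\mathbf{n})v(\mathbf{n})^{-1}v(\mathbf{m})^{-1},\ v(\mathbf{p}) \mid v\in W,\ \mathbf{m}\in M,\ \mathbf{n}\in N,\ \mathbf{p}\in M\wedge N\}.$$ An extension $N\to A$ is a $\mathcal{B}$-central extension (Fröhlich) if the only element of $A$ of the form $v(\mathbf{n}\mathbf{a})v(\mathbf{a})^{-1}$, with $v\in W$, $\mathbf{n}\in N$ and $\mathbf{a}\in A$, is the unit $1$. *)

theory Defs
  imports "HOL-Algebra.Coset" "HOL.Hull"
begin

section \<open>Omega-groups\<close>

text \<open>
  A signature is a partial map \<open>ar\<close>: its domain is the set of operation symbols other than the group
  operations, and \<open>ar w = Some k\<close> says that \<open>w\<close> is \<open>k\<close>-ary. The group operations are those of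
  HOL-Algebra (the inverse being determined by the multiplication), and the other operations of an
  algebra take the list of their arguments.
\<close>

record ('a, 'f) omega_group = "'a monoid" +
  oper :: "'f \<Rightarrow> 'a list \<Rightarrow> 'a"

datatype 'f trm =
    Var nat
  | One
  | Inv "'f trm"
  | Mult "'f trm" "'f trm"
  | Oper 'f "'f trm list"

inductive_set terms :: "('f \<rightharpoonup> nat) \<Rightarrow> 'f trm set" for ar where
  Var: "Var i \<in> terms ar"
| One: "One \<in> terms ar"
| Inv: "t \<in> terms ar \<Longrightarrow> Inv t \<in> terms ar"
| Mult: "s \<in> terms ar \<Longrightarrow> t \<in> terms ar \<Longrightarrow> Mult s t \<in> terms ar"
| Oper: "ar w = Some (length ts) \<Longrightarrow> (\<And>t. t \<in> set ts \<Longrightarrow> t \<in> terms ar) \<Longrightarrow> Oper w ts \<in> terms ar"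

text \<open>
  A finite tuple of elements substituted into a term is represented by an infinite sequence of
  elements; only the finitely many entries whose variables occur in the term matter.
\<close>

primrec eval :: "('a, 'f) omega_group \<Rightarrow> (nat \<Rightarrow> 'a) \<Rightarrow> 'f trm \<Rightarrow> 'a" where
  "eval A x (Var i) = x i"
| "eval A x One = \<one>\<^bsub>A\<^esub>"
| "eval A x (Inv t) = inv\<^bsub>A\<^esub> (eval A x t)"
| "eval A x (Mult s t) = eval A x s \<otimes>\<^bsub>A\<^esub> eval A x t"
| "eval A x (Oper w ts) = oper A w (map (eval A x) ts)"

text \<open>
  The last condition expresses that the unit is the only constant: the unit is a one-element
  subalgebra. For a nullary \<open>w\<close> it says that \<open>w\<close> denotes the unit.
\<close>

definition omega_algebra :: "('f \<rightharpoonup> nat) \<Rightarrow> ('a, 'f) omega_group \<Rightarrow> bool" where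
  "omega_algebra ar A \<longleftrightarrow> group A \<and>
     (\<forall>w xs. ar w = Some (length xs) \<and> set xs \<subseteq> carrier A \<longrightarrow> oper A w xs \<in> carrier A) \<and>
     (\<forall>w k. ar w = Some k \<longrightarrow> oper A w (replicate k \<one>\<^bsub>A\<^esub>) = \<one>\<^bsub>A\<^esub>)"

text \<open>
  The variety of Omega-groups defined by a set \<open>E\<close> of identities, which are imposed in addition to
  the group laws and the laws on the unit. As a HOL set, it is the part of the variety with carriers
  in a given type.
\<close>

definition variety ::
    "('f \<rightharpoonup> nat) \<Rightarrow> ('f trm \<times> 'f trm) set \<Rightarrow> ('a, 'f) omega_group set" where
  "variety ar E = {A. omega_algebra ar A \<and>
     (\<forall>(s, t) \<in> E. \<forall>x. range x \<subseteq> carrier A \<longrightarrow> eval A x s = eval A x t)}"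

text \<open>
  The carriers are taken in the type \<^typ>\<open>'f trm set\<close>, where the free algebras on a countable set
  live. The inclusion then holds for algebras over every type, see \<open>subvariety_all_types\<close> below.
\<close>

definition subvariety ::
    "('f \<rightharpoonup> nat) \<Rightarrow> ('f trm \<times> 'f trm) set \<Rightarrow> ('f trm \<times> 'f trm) set \<Rightarrow> bool" where
  "subvariety ar EB EA \<longleftrightarrow>
     (variety ar EB :: ('f trm set, 'f) omega_group set) \<subseteq> variety ar EA"

definition omega_hom ::
    "('f \<rightharpoonup> nat) \<Rightarrow> ('a, 'f) omega_group \<Rightarrow> ('b, 'f) omega_group \<Rightarrow> ('a \<Rightarrow> 'b) set" where
  "omega_hom ar A B = {h \<in> hom A B.
     \<forall>w xs. ar w = Some (length xs) \<and> set xs \<subseteq> carrier A \<longrightarrow>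
       h (oper A w xs) = oper B w (map h xs)}"

definition subalgebra :: "('f \<rightharpoonup> nat) \<Rightarrow> ('a, 'f) omega_group \<Rightarrow> 'a set \<Rightarrow> bool" where
  "subalgebra ar A S \<longleftrightarrow> subgroup S A \<and>
     (\<forall>w xs. ar w = Some (length xs) \<and> set xs \<subseteq> S \<longrightarrow> oper A w xs \<in> S)"

text \<open>
  The codomain is taken over the type \<^typ>\<open>'a set\<close>, where the quotients of \<open>A\<close> live. The kernels of
  homomorphisms to algebras over other types are ideals too, see \<open>omega_ideal_kernel\<close> below.
\<close>

definition omega_ideal ::
    "('f \<rightharpoonup> nat) \<Rightarrow> ('f trm \<times> 'f trm) set \<Rightarrow> ('a, 'f) omega_group \<Rightarrow> 'a set \<Rightarrow> bool" where
  "omega_ideal ar E A N \<longleftrightarrow> subalgebra ar A N \<and>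
     (\<exists>B \<in> (variety ar E :: ('a set, 'f) omega_group set). \<exists>h \<in> omega_hom ar A B. N = kernel A B h)"

definition join :: "('f \<rightharpoonup> nat) \<Rightarrow> ('a, 'f) omega_group \<Rightarrow> 'a set \<Rightarrow> 'a set \<Rightarrow> 'a set" where
  "join ar A M N = subalgebra ar A hull (M \<union> N)"


section \<open>Commutators and central extensions relative to a subvariety\<close>

text \<open>
  Elements of the free algebra on a countable set are represented by terms; whether a term belongs to
  \<open>W\<close>, and its values in algebras of the variety, depend only on the element represented. Again the
  carriers in the type \<^typ>\<open>'f trm set\<close> suffice, see \<open>W_all_types\<close> below.
\<close>

definition W :: "('f \<rightharpoonup> nat) \<Rightarrow> ('f trm \<times> 'f trm) set \<Rightarrow> 'f trm set" where
  "W ar EB = {v \<in> terms ar. \<forall>B \<in> (variety ar EB :: ('f trm set, 'f) omega_group set).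
     \<forall>b. range b \<subseteq> carrier B \<longrightarrow> eval B b v = \<one>\<^bsub>B\<^esub>}"

definition commutator ::
    "('f \<rightharpoonup> nat) \<Rightarrow> ('f trm \<times> 'f trm) set \<Rightarrow> ('f trm \<times> 'f trm) set \<Rightarrow>
     ('a, 'f) omega_group \<Rightarrow> 'a set \<Rightarrow> 'a set \<Rightarrow> 'a set" where
  "commutator ar EA EB A M N =
     omega_ideal ar EA (A\<lparr>carrier := join ar A M N\<rparr>) hull
       ({eval A (\<lambda>i. m i \<otimes>\<^bsub>A\<^esub> n i) v \<otimes>\<^bsub>A\<^esub> inv\<^bsub>A\<^esub> (eval A n v) \<otimes>\<^bsub>A\<^esub> inv\<^bsub>A\<^esub> (eval A m v) | v m n.
           v \<in> W ar EB \<and> range m \<subseteq> M \<and> range n \<subseteq> N} \<union>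
        {eval A p v | v p. v \<in> W ar EB \<and> range p \<subseteq> M \<inter> N})"

definition central_extension ::
    "('f \<rightharpoonup> nat) \<Rightarrow> ('f trm \<times> 'f trm) set \<Rightarrow> ('a, 'f) omega_group \<Rightarrow> 'a set \<Rightarrow> bool" where
  "central_extension ar EB A N \<longleftrightarrow>
     {eval A (\<lambda>i. n i \<otimes>\<^bsub>A\<^esub> a i) v \<otimes>\<^bsub>A\<^esub> inv\<^bsub>A\<^esub> (eval A a v) | v n a.
        v \<in> W ar EB \<and> range n \<subseteq> N \<and> range a \<subseteq> carrier A} = {\<one>\<^bsub>A\<^esub>}"


section \<open>Independence of the carrier types\<close>

lemma variety_omega_algebra: "A \<in> variety ar E \<Longrightarrow> omega_algebra ar A"
  by (simp add: variety_def)

lemma eval_in_subalgebra: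
  assumes "t \<in> terms ar" "subalgebra ar A S" "range x \<subseteq> S"
  shows "eval A x t \<in> S"
  using assms(1)
proof induction
  case (Oper w ts)
  then have "set (map (eval A x) ts) \<subseteq> S" by auto
  then show ?case
    using assms(2) Oper.hyps unfolding subalgebra_def by (simp del: set_map)
qed (use assms in \<open>auto simp: subalgebra_def subgroup_def\<close>)

lemma subalgebra_carrier:
  assumes "omega_algebra ar A" shows "subalgebra ar A (carrier A)"
  using assms by (auto simp: omega_algebra_def subalgebra_def group.subgroup_self)

lemma eval_closed:
  assumes "omega_algebra ar A" "t \<in> terms ar" "range x \<subseteq> carrier A"
  shows "eval A x t \<in> carrier A"
  using eval_in_subalgebra[OF assms(2) subalgebra_carrier[OF assms(1)] assms(3)] .

lemma hom_eval:
  assumes A: "omega_algebra ar A" and B: "group B" and h: "h \<in> omega_hom ar A B"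
    and t: "t \<in> terms ar" and x: "range x \<subseteq> carrier A"
  shows "h (eval A x t) = eval B (h \<circ> x) t"
proof -
  interpret group_hom A B h
    using A B h by (auto simp: omega_algebra_def omega_hom_def group_hom_def group_hom_axioms_def)
  define y where "y = h \<circ> x"
  have y: "h (x i) = y i" for i by (simp add: y_def)
  have "h (eval A x t) = eval B y t" using t
  proof induction
    case (Oper w ts)
    have "set (map (eval A x) ts) \<subseteq> carrier A"
      using Oper.hyps eval_closed[OF A _ x] by auto
    then have "h (oper A w (map (eval A x) ts)) = oper B w (map h (map (eval A x) ts))"
      using h Oper.hyps(1) by (simp add: omega_hom_def del: set_map map_map)
    moreover have "map h (map (eval A x) ts) = map (eval B y) ts"
      using Oper.IH by simp
    ultimately show ?case by (simp only: eval.simps)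
  qed (use eval_closed[OF A _ x] y in simp_all)
  then show ?thesis by (simp only: y_def)
qed

lemma variety_surj:
  assumes A: "A \<in> variety ar E" and E: "E \<subseteq> terms ar \<times> terms ar"
    and h: "h \<in> omega_hom ar A B" and one: "h \<one>\<^bsub>A\<^esub> = \<one>\<^bsub>B\<^esub>" and surj: "carrier B = h ` carrier A"
  shows "B \<in> variety ar E"
proof -
  have oA: "omega_algebra ar A" using A by (rule variety_omega_algebra)
  then have gA: "group A" by (simp add: omega_algebra_def)
  have "group (B\<lparr>carrier := h ` carrier A, one := h \<one>\<^bsub>A\<^esub>\<rparr>)"
    using group.hom_imp_img_group[OF gA] h by (auto simp: omega_hom_def)
  then have gB: "group B" by (simp add: one surj[symmetric])
  have lift: "\<exists>ys. set ys \<subseteq> carrier A \<and> xs = map h ys" if "set xs \<subseteq> carrier B" for xs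
  proof -
    have "xs \<in> map h ` lists (carrier A)"
      using that unfolding surj lists_image[symmetric] by auto
    then show ?thesis by (auto simp: in_lists_conv_set)
  qed
  have closed: "oper B w xs \<in> carrier B"
    if w: "ar w = Some (length xs)" and xs: "set xs \<subseteq> carrier B" for w xs
  proof -
    obtain ys where ys: "set ys \<subseteq> carrier A" "xs = map h ys" using lift xs by blast
    then have "oper B w xs = h (oper A w ys)" using h w by (simp add: omega_hom_def)
    moreover have "oper A w ys \<in> carrier A" using oA w ys by (simp add: omega_algebra_def)
    ultimately show ?thesis by (simp add: surj)
  qed
  have unit: "oper B w (replicate k \<one>\<^bsub>B\<^esub>) = \<one>\<^bsub>B\<^esub>" if w: "ar w = Some k" for w k
  proof -
    have "set (replicate k \<one>\<^bsub>A\<^esub>) \<subseteq> carrier A"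
      using gA by (auto simp: group.is_monoid monoid.one_closed set_replicate_conv_if)
    then have "h (oper A w (replicate k \<one>\<^bsub>A\<^esub>)) = oper B w (map h (replicate k \<one>\<^bsub>A\<^esub>))"
      using h w unfolding omega_hom_def by simp
    then show ?thesis using oA w by (simp add: omega_algebra_def one)
  qed
  have "eval B x s = eval B x t" if st: "(s, t) \<in> E" and x: "range x \<subseteq> carrier B" for s t x
  proof -
    define y where "y i = inv_into (carrier A) h (x i)" for i
    have xi: "x i \<in> h ` carrier A" for i using x by (auto simp: surj)
    have y: "range y \<subseteq> carrier A" using inv_into_into[OF xi] by (auto simp: y_def)
    have hy: "h \<circ> y = x" using f_inv_into_f[OF xi] by (auto simp: y_def)
    have "eval A y s = eval A y t" using A st y by (auto simp: variety_def)
    moreover have "s \<in> terms ar" "t \<in> terms ar" using E st by auto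
    ultimately show ?thesis using hom_eval[OF oA gB h _ y] by (metis hy)
  qed
  then show ?thesis
    using gB closed unit by (auto simp: variety_def omega_algebra_def)
qed

lemma variety_subalgebra:
  assumes A: "A \<in> variety ar E" and E: "E \<subseteq> terms ar \<times> terms ar" and S: "subalgebra ar A S"
  shows "A\<lparr>carrier := S\<rparr> \<in> variety ar E"
proof -
  have oA: "omega_algebra ar A" using A by (rule variety_omega_algebra)
  then have gA: "group A" by (simp add: omega_algebra_def)
  have sg: "subgroup S A" using S by (simp add: subalgebra_def)
  have gS: "group (A\<lparr>carrier := S\<rparr>)" using group.subgroup_imp_group[OF gA sg] .
  have oS: "omega_algebra ar (A\<lparr>carrier := S\<rparr>)"
    using oA gS S by (auto simp: omega_algebra_def subalgebra_def)
  have SA: "S \<subseteq> carrier A" using sg by (rule subgroup.subset)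
  have incl: "id \<in> omega_hom ar (A\<lparr>carrier := S\<rparr>) A"
    using SA by (auto simp: omega_hom_def hom_def)
  have "eval (A\<lparr>carrier := S\<rparr>) x t = eval A x t" if "t \<in> terms ar" "range x \<subseteq> S" for x t
    using hom_eval[OF oS gA incl] that by simp
  moreover have "eval A x s = eval A x t" if "(s, t) \<in> E" "range x \<subseteq> S" for x s t
  proof -
    have "range x \<subseteq> carrier A" using that(2) SA by (rule order_trans)
    then show ?thesis using A that(1) by (auto simp: variety_def)
  qed
  ultimately have "eval (A\<lparr>carrier := S\<rparr>) x s = eval (A\<lparr>carrier := S\<rparr>) x t"
    if "(s, t) \<in> E" "range x \<subseteq> S" for x s t
    using that E by (metis (no_types, lifting) mem_Sigma_iff subsetD)
  then show ?thesis
    using oS by (auto simp: variety_def)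
qed

definition transport ::
    "('a \<Rightarrow> 'b) \<Rightarrow> ('a, 'f) omega_group \<Rightarrow> ('b, 'f) omega_group" where
  "transport f A = (let g = inv_into (carrier A) f in
     \<lparr>carrier = f ` carrier A, monoid.mult = (\<lambda>x y. f (g x \<otimes>\<^bsub>A\<^esub> g y)), one = f \<one>\<^bsub>A\<^esub>,
      oper = (\<lambda>w xs. f (oper A w (map g xs)))\<rparr>)"

lemma transport:
  assumes A: "A \<in> variety ar E" and E: "E \<subseteq> terms ar \<times> terms ar" and f: "inj_on f (carrier A)"
  shows "f \<in> omega_hom ar A (transport f A)" and "transport f A \<in> variety ar E"
proof -
  have gA: "group A" using variety_omega_algebra[OF A] by (simp add: omega_algebra_def)
  have "map (inv_into (carrier A) f \<circ> f) xs = xs" if "set xs \<subseteq> carrier A" for xs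
    using that f by (intro map_idI) (auto simp: inv_into_f_f)
  then show *: "f \<in> omega_hom ar A (transport f A)"
    using f gA by (auto simp: omega_hom_def hom_def transport_def Let_def inv_into_f_f)
  show "transport f A \<in> variety ar E"
    by (rule variety_surj[OF A E *]) (simp_all add: transport_def Let_def)
qed

lemma omega_ideal_kernel:
  fixes A :: "('a, 'f) omega_group" and B :: "('b, 'f) omega_group"
  assumes A: "A \<in> variety ar E" and B: "B \<in> variety ar E" and E: "E \<subseteq> terms ar \<times> terms ar"
    and h: "h \<in> omega_hom ar A B"
  shows "omega_ideal ar E A (kernel A B h)"
proof -
  have oA: "omega_algebra ar A" and oB: "omega_algebra ar B"
    using A B by (auto intro: variety_omega_algebra)
  interpret group_hom A B h
    using oA oB h by (auto simp: omega_algebra_def omega_hom_def group_hom_def group_hom_axioms_def)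
  have "oper A w xs \<in> kernel A B h"
    if w: "ar w = Some (length xs)" and xs: "set xs \<subseteq> kernel A B h" for w xs
  proof -
    have xA: "set xs \<subseteq> carrier A" using xs by (auto simp: kernel_def)
    have "map h xs = replicate (length xs) \<one>\<^bsub>B\<^esub>"
      using xs by (auto intro!: replicate_eqI simp: kernel_def)
    then have "h (oper A w xs) = \<one>\<^bsub>B\<^esub>"
      using h w xA oB by (simp add: omega_hom_def omega_algebra_def)
    then show ?thesis using oA w xA by (simp add: omega_algebra_def kernel_def)
  qed
  then have sub: "subalgebra ar A (kernel A B h)"
    using subgroup_kernel by (simp add: subalgebra_def)
  define S where "S = h ` carrier A"
  have "subalgebra ar B S"
  proof -
    have "oper B w xs \<in> S" if w: "ar w = Some (length xs)" and xs: "set xs \<subseteq> S" for w xs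
    proof -
      have "xs \<in> map h ` lists (carrier A)"
        using xs unfolding S_def lists_image[symmetric] by auto
      then obtain ys where ys: "set ys \<subseteq> carrier A" "xs = map h ys"
        by (auto simp: in_lists_conv_set)
      then have "oper B w xs = h (oper A w ys)" using h w by (simp add: omega_hom_def)
      then show ?thesis using oA w ys by (simp add: omega_algebra_def S_def)
    qed
    then show ?thesis using img_is_subgroup by (simp add: subalgebra_def S_def)
  qed
  then have BS: "B\<lparr>carrier := S\<rparr> \<in> variety ar E" using variety_subalgebra[OF B E] by simp
  define f where "f b = {a \<in> carrier A. h a = b}" for b
  have "inj_on f S" by (auto simp: inj_on_def f_def S_def set_eq_iff)
  then have inj: "inj_on f (carrier (B\<lparr>carrier := S\<rparr>))" by simp
  define C where "C = transport f (B\<lparr>carrier := S\<rparr>)"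
  note C = transport[OF BS E inj, folded C_def]
  have "f \<circ> h \<in> omega_hom ar A C"
  proof -
    have "f (h (oper A w xs)) = oper C w (map (f \<circ> h) xs)"
      if w: "ar w = Some (length xs)" and xs: "set xs \<subseteq> carrier A" for w xs
    proof -
      have "set (map h xs) \<subseteq> S" using xs by (auto simp: S_def)
      then have "f (oper B w (map h xs)) = oper C w (map f (map h xs))"
        using C(1) w by (simp add: omega_hom_def del: set_map map_map)
      then show ?thesis using h w xs by (simp add: omega_hom_def)
    qed
    then show ?thesis
      using C(1) h by (auto simp: omega_hom_def hom_def S_def Pi_iff)
  qed
  moreover have "kernel A C (f \<circ> h) = kernel A B h"
  proof -
    have "\<one>\<^bsub>B\<^esub> \<in> S" using imageI[OF G.one_closed, of h] by (simp add: S_def)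
    moreover have "\<one>\<^bsub>C\<^esub> = f \<one>\<^bsub>B\<^esub>" by (simp add: C_def transport_def Let_def)
    ultimately show ?thesis
      using \<open>inj_on f S\<close> by (auto simp: kernel_def S_def inj_on_def)
  qed
  ultimately show ?thesis
    using sub C(2) unfolding omega_ideal_def by metis
qed

lemma identity_all_types:
  fixes A :: "('a, 'f) omega_group"
  assumes A: "A \<in> variety ar E" and E: "E \<subseteq> terms ar \<times> terms ar"
    and s: "s \<in> terms ar" and t: "t \<in> terms ar"
    and st: "\<And>B y. B \<in> (variety ar E :: ('f trm set, 'f) omega_group set) \<Longrightarrow>
      range y \<subseteq> carrier B \<Longrightarrow> eval B y s = eval B y t"
    and x: "range x \<subseteq> carrier A"
  shows "eval A x s = eval A x t"
proof -
  have oA: "omega_algebra ar A" using A by (rule variety_omega_algebra)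
  then have gA: "group A" by (simp add: omega_algebra_def)
  define S where "S = eval A x ` terms ar"
  have "subgroup S A"
  proof (rule group.subgroupI[OF gA])
    show "S \<subseteq> carrier A" using eval_closed[OF oA _ x] by (auto simp: S_def)
    show "S \<noteq> {}" using terms.One by (auto simp: S_def)
    show "inv\<^bsub>A\<^esub> a \<in> S" if a: "a \<in> S" for a
    proof -
      obtain u where "u \<in> terms ar" "a = eval A x u" using a unfolding S_def by blast
      then show ?thesis
        using imageI[OF terms.Inv, of u ar "eval A x"] by (simp add: S_def)
    qed
    show "a \<otimes>\<^bsub>A\<^esub> b \<in> S" if ab: "a \<in> S" "b \<in> S" for a b
    proof -
      obtain u v where "u \<in> terms ar" "v \<in> terms ar" "a = eval A x u" "b = eval A x v"
        using ab unfolding S_def by blast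
      then show ?thesis
        using imageI[OF terms.Mult, of u ar v "eval A x"] by (simp add: S_def)
    qed
  qed
  moreover have "oper A w xs \<in> S" if w: "ar w = Some (length xs)" and xs: "set xs \<subseteq> S" for w xs
  proof -
    have "xs \<in> map (eval A x) ` lists (terms ar)"
      using xs unfolding S_def lists_image[symmetric] by auto
    then obtain ts where ts: "set ts \<subseteq> terms ar" "xs = map (eval A x) ts"
      by (auto simp: in_lists_conv_set)
    then have "Oper w ts \<in> terms ar" using w by (auto intro!: terms.Oper)
    then have "eval A x (Oper w ts) \<in> S" unfolding S_def by (rule imageI)
    then show ?thesis using ts by simp
  qed
  ultimately have S: "subalgebra ar A S" by (simp add: subalgebra_def)
  then have AS: "A\<lparr>carrier := S\<rparr> \<in> variety ar E" using variety_subalgebra[OF A E] by simp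
  have gS: "group (A\<lparr>carrier := S\<rparr>)" and oS: "omega_algebra ar (A\<lparr>carrier := S\<rparr>)"
    using variety_omega_algebra[OF AS] by (simp_all add: omega_algebra_def)
  have SA: "S \<subseteq> carrier A" using \<open>subgroup S A\<close> by (rule subgroup.subset)
  have "x i \<in> S" for i
    unfolding S_def using imageI[OF terms.Var, of "eval A x" i ar] by simp
  then have xS: "range x \<subseteq> S" by auto
  define f where "f b = {u \<in> terms ar. eval A x u = b}" for b
  have "inj_on f S"
  proof (rule inj_onI)
    fix a b assume "a \<in> S" "f a = f b"
    then obtain u where "u \<in> terms ar" "eval A x u = a" unfolding S_def by blast
    then have "u \<in> f a" by (simp add: f_def)
    with \<open>f a = f b\<close> have "u \<in> f b" by (simp only:)
    with \<open>eval A x u = a\<close> show "a = b" by (simp add: f_def)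
  qed
  then have inj: "inj_on f (carrier (A\<lparr>carrier := S\<rparr>))" by simp
  define C where "C = transport f (A\<lparr>carrier := S\<rparr>)"
  note C = transport[OF AS E inj, folded C_def]
  have gC: "group C" using variety_omega_algebra[OF C(2)] by (simp add: omega_algebra_def)
  have "id \<in> omega_hom ar (A\<lparr>carrier := S\<rparr>) A"
    using SA by (auto simp: omega_hom_def hom_def)
  then have ev: "eval (A\<lparr>carrier := S\<rparr>) x u = eval A x u" if "u \<in> terms ar" for u
    using hom_eval[OF oS gA _ that, of id x] xS by simp
  have "range (f \<circ> x) \<subseteq> carrier C" using xS by (auto simp: C_def transport_def Let_def)
  then have "eval C (f \<circ> x) s = eval C (f \<circ> x) t" using st[OF C(2)] by blast
  then have "f (eval A x s) = f (eval A x t)"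
    using hom_eval[OF oS gC C(1), of _ x] xS s t ev by simp
  then show ?thesis
    using \<open>inj_on f S\<close> s t by (auto simp: inj_on_def S_def)
qed

lemma subvariety_all_types:
  fixes A :: "('a, 'f) omega_group"
  assumes sub: "subvariety ar EB EA" and EA: "EA \<subseteq> terms ar \<times> terms ar"
    and EB: "EB \<subseteq> terms ar \<times> terms ar" and A: "A \<in> variety ar EB"
  shows "A \<in> variety ar EA"
proof -
  have "eval A x s = eval A x t" if st: "(s, t) \<in> EA" and x: "range x \<subseteq> carrier A" for s t x
  proof (rule identity_all_types[OF A EB _ _ _ x])
    show "s \<in> terms ar" "t \<in> terms ar" using EA st by auto
    show "eval B y s = eval B y t"
      if "B \<in> (variety ar EB :: ('f trm set, 'f) omega_group set)" "range y \<subseteq> carrier B" for B y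
      using sub st that by (fastforce simp: subvariety_def variety_def)
  qed
  then show ?thesis using variety_omega_algebra[OF A] by (auto simp: variety_def)
qed

lemma W_all_types:
  fixes B :: "('b, 'f) omega_group"
  assumes v: "v \<in> W ar EB" and EB: "EB \<subseteq> terms ar \<times> terms ar" and B: "B \<in> variety ar EB"
    and b: "range b \<subseteq> carrier B"
  shows "eval B b v = \<one>\<^bsub>B\<^esub>"
proof -
  have "eval B b v = eval B b One"
    by (rule identity_all_types[OF B EB _ _ _ b]) (use v in \<open>auto simp: W_def intro: terms.One\<close>)
  then show ?thesis by simp
qed

end

theory Submission
  imports Defs
begin

text \<open>
  Putting \<open>a = 1\<close> in the centrality condition \<open>v(na) = v(a)\<close> gives \<open>v(n) = 1\<close>. So centrality says
  precisely that all the generators of \<open>[N, A]\<close> are trivial, where \<open>N \<or> A = A\<close> and \<open>N \<and> A = N\<close>.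
\<close>

text \<open>The commutator is generated as an ideal of the join; for \<open>M = N\<close> this
  identifies that ambient algebra as \<open>A\<close> itself.\<close>

lemma join_carrier:
  assumes "omega_algebra ar A" and "M \<subseteq> carrier A"
  shows "join ar A M (carrier A) = carrier A"
  unfolding join_def
proof
  show "subalgebra ar A hull (M \<union> carrier A) \<subseteq> carrier A"
    using assms by (intro hull_minimal subalgebra_carrier) auto
  show "carrier A \<subseteq> subalgebra ar A hull (M \<union> carrier A)"
    using hull_subset[of "M \<union> carrier A" "subalgebra ar A"] by blast
qed

text \<open>The identity of \<open>A\<close> has trivial kernel. Its codomain lives over
  \<open>'a\<close>, whereas \<open>omega_ideal\<close> asks for one over \<open>'a set\<close>;
  \<open>omega_ideal_kernel\<close> bridges the two types.\<close>

lemma omega_ideal_one: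
  assumes A: "A \<in> variety ar E" and E: "E \<subseteq> terms ar \<times> terms ar"
  shows "omega_ideal ar E A {\<one>\<^bsub>A\<^esub>}"
proof -
  have "group A" using variety_omega_algebra[OF A] by (simp add: omega_algebra_def)
  then have "kernel A A id = {\<one>\<^bsub>A\<^esub>}"
    by (auto simp: kernel_def group.is_monoid monoid.one_closed)
  moreover have "id \<in> omega_hom ar A A" by (auto simp: omega_hom_def hom_def)
  ultimately show ?thesis using omega_ideal_kernel[OF A A E, of id] by simp
qed

text \<open>Reduces triviality of a generated ideal to its generators: \<open>{1}\<close> is itself
  an ideal, hence one of the sets intersected in the hull as soon as it contains
  \<open>S\<close>.\<close>

lemma omega_ideal_hull_eq_one_iff:
  assumes A: "A \<in> variety ar E" and E: "E \<subseteq> terms ar \<times> terms ar"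
  shows "omega_ideal ar E A hull S = {\<one>\<^bsub>A\<^esub>} \<longleftrightarrow> S \<subseteq> {\<one>\<^bsub>A\<^esub>}"
proof
  assume "omega_ideal ar E A hull S = {\<one>\<^bsub>A\<^esub>}"
  then show "S \<subseteq> {\<one>\<^bsub>A\<^esub>}" using hull_subset[of S "omega_ideal ar E A"] by simp
next
  assume "S \<subseteq> {\<one>\<^bsub>A\<^esub>}"
  then have "omega_ideal ar E A hull S \<subseteq> {\<one>\<^bsub>A\<^esub>}"
    using omega_ideal_one[OF A E] by (intro hull_minimal)
  \<comment> \<open>The hull is an intersection of ideals, each of which is a subgroup and so
    contains the unit.\<close>
  moreover have "\<one>\<^bsub>A\<^esub> \<in> omega_ideal ar E A hull S"
    unfolding hull_def omega_ideal_def subalgebra_def by (auto intro: subgroup.one_closed)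
  ultimately show "omega_ideal ar E A hull S = {\<one>\<^bsub>A\<^esub>}" by blast
qed

text \<open>This is where the unit being the only constant enters. In the \<open>Oper\<close> case
  the arguments become \<open>length ts\<close> copies of the unit, and \<open>length ts\<close> is
  the arity of \<open>w\<close>, so the unit law in \<open>omega_algebra\<close> applies.\<close>

lemma eval_const_one:
  assumes A: "omega_algebra ar A" and "t \<in> terms ar"
  shows "eval A (\<lambda>_. \<one>\<^bsub>A\<^esub>) t = \<one>\<^bsub>A\<^esub>"
  using assms(2)
proof induction
  case (Oper w ts)
  have "map (eval A (\<lambda>_. \<one>\<^bsub>A\<^esub>)) ts = replicate (length ts) \<one>\<^bsub>A\<^esub>"
    using Oper.IH by (auto intro!: replicate_eqI)
  then show ?case using A Oper.hyps(1) by (simp add: omega_algebra_def)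
qed (use A in \<open>simp_all add: omega_algebra_def group.is_monoid monoid.inv_one\<close>)

lemma (in group) mult_inv_eq_one_iff:
  assumes x: "x \<in> carrier G" and y: "y \<in> carrier G"
  shows "x \<otimes> inv y = \<one> \<longleftrightarrow> x = y"
  \<comment> \<open>From \<open>x \<otimes> inv y = \<one>\<close> this yields
    \<open>inv (inv y) = x\<close>.\<close>
  using inv_equality[of x "inv y"] x y by auto

lemma One_in_W: "One \<in> W ar E"
  by (simp add: W_def terms.One)

text \<open>Cancelling in the group turns each condition on an element of the defining set into an
  equation between term values. The definition demands equality with \<open>{1}\<close>, so the set
  must also be shown to contain the unit.\<close>

lemma central_extension_iff:
  assumes A: "omega_algebra ar A" and N: "N \<subseteq> carrier A" and one: "\<one>\<^bsub>A\<^esub> \<in> N"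
  shows "central_extension ar E A N \<longleftrightarrow>
    (\<forall>v\<in>W ar E. \<forall>n a. range n \<subseteq> N \<and> range a \<subseteq> carrier A \<longrightarrow>
      eval A (\<lambda>i. n i \<otimes>\<^bsub>A\<^esub> a i) v = eval A a v)"
proof -
  interpret group A using A by (simp add: omega_algebra_def)
  define S where "S = {eval A (\<lambda>i. n i \<otimes>\<^bsub>A\<^esub> a i) v \<otimes>\<^bsub>A\<^esub> inv\<^bsub>A\<^esub> (eval A a v) | v n a.
    v \<in> W ar E \<and> range n \<subseteq> N \<and> range a \<subseteq> carrier A}"
  have cancel: "eval A (\<lambda>i. n i \<otimes>\<^bsub>A\<^esub> a i) v \<otimes>\<^bsub>A\<^esub> inv\<^bsub>A\<^esub> (eval A a v) = \<one>\<^bsub>A\<^esub> \<longleftrightarrow>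
      eval A (\<lambda>i. n i \<otimes>\<^bsub>A\<^esub> a i) v = eval A a v"
    if "v \<in> W ar E" "range n \<subseteq> N" "range a \<subseteq> carrier A" for v n a
  proof -
    have v: "v \<in> terms ar" using that(1) by (simp add: W_def)
    have "range (\<lambda>i. n i \<otimes>\<^bsub>A\<^esub> a i) \<subseteq> carrier A"
      using that(2,3) N by (auto simp: image_subset_iff)
    then show ?thesis
      using eval_closed[OF A v] that(3) by (intro mult_inv_eq_one_iff)
  qed
  \<comment> \<open>The term \<open>One\<close> lies in \<open>W\<close> and has value 1 at every
    tuple; constant unit tuples serve as \<open>n\<close> and \<open>a\<close>.\<close>
  have "\<one>\<^bsub>A\<^esub> \<in> S"
    unfolding S_def
    by (rule CollectI, rule exI[of _ One], rule exI[of _ "\<lambda>_. \<one>\<^bsub>A\<^esub>"], rule exI[of _ "\<lambda>_. \<one>\<^bsub>A\<^esub>"])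
      (use one One_in_W in auto)
  then have "S = {\<one>\<^bsub>A\<^esub>} \<longleftrightarrow> (\<forall>s\<in>S. s = \<one>\<^bsub>A\<^esub>)" by blast
  also have "\<dots> \<longleftrightarrow> (\<forall>v\<in>W ar E. \<forall>n a. range n \<subseteq> N \<and> range a \<subseteq> carrier A \<longrightarrow>
      eval A (\<lambda>i. n i \<otimes>\<^bsub>A\<^esub> a i) v \<otimes>\<^bsub>A\<^esub> inv\<^bsub>A\<^esub> (eval A a v) = \<one>\<^bsub>A\<^esub>)"
    unfolding S_def by auto
  finally show ?thesis unfolding central_extension_def S_def using cancel by simp
qed

theorem proposition2p2:
  fixes ar :: "'f \<rightharpoonup> nat"
    and EA EB :: "('f trm \<times> 'f trm) set"
    and A :: "('a, 'f) omega_group"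
    and N :: "'a set"
  assumes "EA \<subseteq> terms ar \<times> terms ar"
    and "EB \<subseteq> terms ar \<times> terms ar"
    and "subvariety ar EB EA"
    and "A \<in> variety ar EA"
    and "omega_ideal ar EA A N"
  shows "central_extension ar EB A N \<longleftrightarrow> commutator ar EA EB A N (carrier A) = {\<one>\<^bsub>A\<^esub>}"
proof -
  have oA: "omega_algebra ar A" using assms(4) by (rule variety_omega_algebra)
  then interpret group A by (simp add: omega_algebra_def)
  have sub: "subgroup N A" using assms(5) by (simp add: omega_ideal_def subalgebra_def)
  note N = subgroup.subset[OF sub] and one = subgroup.one_closed[OF sub]
  have W: "v \<in> terms ar" if "v \<in> W ar EB" for v using that by (simp add: W_def)
  \<comment> \<open>With \<open>carrier A\<close> as second argument, the join is
    \<open>carrier A\<close>, the intersection is \<open>N\<close>, and replacing the carrier of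
    \<open>A\<close> by itself gives back \<open>A\<close>. Triviality then splits along the two
    families of generators.\<close>
  have trivial: "commutator ar EA EB A N (carrier A) = {\<one>\<^bsub>A\<^esub>} \<longleftrightarrow>
      (\<forall>v\<in>W ar EB. \<forall>n a. range n \<subseteq> N \<and> range a \<subseteq> carrier A \<longrightarrow>
        eval A (\<lambda>i. n i \<otimes>\<^bsub>A\<^esub> a i) v \<otimes>\<^bsub>A\<^esub> inv\<^bsub>A\<^esub> (eval A a v) \<otimes>\<^bsub>A\<^esub> inv\<^bsub>A\<^esub> (eval A n v) = \<one>\<^bsub>A\<^esub>) \<and>
      (\<forall>v\<in>W ar EB. \<forall>p. range p \<subseteq> N \<longrightarrow> eval A p v = \<one>\<^bsub>A\<^esub>)"
    unfolding commutator_def join_carrier[OF oA N] Int_absorb2[OF N]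
    by (simp add: omega_ideal_hull_eq_one_iff[OF assms(4,1)]) blast
  show ?thesis
    unfolding trivial central_extension_iff[OF oA N one]
  proof
    assume central: "\<forall>v\<in>W ar EB. \<forall>n a. range n \<subseteq> N \<and> range a \<subseteq> carrier A \<longrightarrow>
        eval A (\<lambda>i. n i \<otimes>\<^bsub>A\<^esub> a i) v = eval A a v"
    have p1: "eval A p v = \<one>\<^bsub>A\<^esub>" if v: "v \<in> W ar EB" and p: "range p \<subseteq> N" for v p
    proof -
      \<comment> \<open>Rewrites the tuple \<open>p\<close> times the constant unit tuple as
        \<open>p\<close>, so that centrality at \<open>a = 1\<close> speaks about
        \<open>eval A p v\<close>.\<close>
      have "p i \<otimes>\<^bsub>A\<^esub> \<one>\<^bsub>A\<^esub> = p i" for i using p N by (simp add: image_subset_iff subset_iff)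
      moreover have "eval A (\<lambda>i. p i \<otimes>\<^bsub>A\<^esub> \<one>\<^bsub>A\<^esub>) v = eval A (\<lambda>_. \<one>\<^bsub>A\<^esub>) v"
        using central v p by (auto simp: image_subset_iff)
      ultimately show ?thesis using eval_const_one[OF oA W[OF v]] by simp
    qed
    \<comment> \<open>Centrality cancels the first two factors, and \<open>p1\<close> applied to
      \<open>n\<close> makes the third one trivial.\<close>
    moreover have "eval A (\<lambda>i. n i \<otimes>\<^bsub>A\<^esub> a i) v \<otimes>\<^bsub>A\<^esub> inv\<^bsub>A\<^esub> (eval A a v) \<otimes>\<^bsub>A\<^esub> inv\<^bsub>A\<^esub> (eval A n v) = \<one>\<^bsub>A\<^esub>"
      if v: "v \<in> W ar EB" and na: "range n \<subseteq> N" "range a \<subseteq> carrier A" for v n a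
      using central v na p1[of v n] eval_closed[OF oA W[OF v], of a] by simp
    ultimately show "(\<forall>v\<in>W ar EB. \<forall>n a. range n \<subseteq> N \<and> range a \<subseteq> carrier A \<longrightarrow>
        eval A (\<lambda>i. n i \<otimes>\<^bsub>A\<^esub> a i) v \<otimes>\<^bsub>A\<^esub> inv\<^bsub>A\<^esub> (eval A a v) \<otimes>\<^bsub>A\<^esub> inv\<^bsub>A\<^esub> (eval A n v) = \<one>\<^bsub>A\<^esub>) \<and>
      (\<forall>v\<in>W ar EB. \<forall>p. range p \<subseteq> N \<longrightarrow> eval A p v = \<one>\<^bsub>A\<^esub>)" by blast
  next
    assume gens: "(\<forall>v\<in>W ar EB. \<forall>n a. range n \<subseteq> N \<and> range a \<subseteq> carrier A \<longrightarrow>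
        eval A (\<lambda>i. n i \<otimes>\<^bsub>A\<^esub> a i) v \<otimes>\<^bsub>A\<^esub> inv\<^bsub>A\<^esub> (eval A a v) \<otimes>\<^bsub>A\<^esub> inv\<^bsub>A\<^esub> (eval A n v) = \<one>\<^bsub>A\<^esub>) \<and>
      (\<forall>v\<in>W ar EB. \<forall>p. range p \<subseteq> N \<longrightarrow> eval A p v = \<one>\<^bsub>A\<^esub>)"
    have "eval A (\<lambda>i. n i \<otimes>\<^bsub>A\<^esub> a i) v = eval A a v"
      if v: "v \<in> W ar EB" and na: "range n \<subseteq> N \<and> range a \<subseteq> carrier A" for v n a
    proof -
      have a: "eval A a v \<in> carrier A" using eval_closed[OF oA W[OF v]] na by blast
      have "range (\<lambda>i. n i \<otimes>\<^bsub>A\<^esub> a i) \<subseteq> carrier A" using na N by (auto simp: image_subset_iff)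
      then have b: "eval A (\<lambda>i. n i \<otimes>\<^bsub>A\<^esub> a i) v \<in> carrier A" using eval_closed[OF oA W[OF v]] by blast
      \<comment> \<open>The tuple \<open>n\<close> has its entries in \<open>N\<close>, so it may be
        used as \<open>p\<close> in the second family of generators; the last factor of the first
        family then disappears.\<close>
      have "eval A n v = \<one>\<^bsub>A\<^esub>" using gens v na by blast
      moreover have "eval A (\<lambda>i. n i \<otimes>\<^bsub>A\<^esub> a i) v \<otimes>\<^bsub>A\<^esub> inv\<^bsub>A\<^esub> (eval A a v)
          \<otimes>\<^bsub>A\<^esub> inv\<^bsub>A\<^esub> (eval A n v) = \<one>\<^bsub>A\<^esub>"
        using gens v na by blast
      ultimately have "eval A (\<lambda>i. n i \<otimes>\<^bsub>A\<^esub> a i) v \<otimes>\<^bsub>A\<^esub> inv\<^bsub>A\<^esub> (eval A a v) = \<one>\<^bsub>A\<^esub>"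
        using a b by simp
      then show ?thesis
        using mult_inv_eq_one_iff[OF b a] by blast
    qed
    then show "\<forall>v\<in>W ar EB. \<forall>n a. range n \<subseteq> N \<and> range a \<subseteq> carrier A \<longrightarrow>
        eval A (\<lambda>i. n i \<otimes>\<^bsub>A\<^esub> a i) v = eval A a v" by blast
  qed
qed

end
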